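(* Let $(p_x)_{x\in\mathcal M}$ be a continuous family of probability measures on $\mathcal M$ such that $p_x=q_x\,\mathrm{Leb}$, where each $q_x$ is a positive Hölder continuous (for some exponent $\alpha>0$) probability density, varying continuously with $x\in\mathcal M$ in the $C^0$-topology. Assume that there are $\rho_0>0$, $\overline q>\underline q>0$, a subset $Y\subset\mathcal M$ of full $\mathrm{Leb}$-measure and a map $f:\mathcal M\to\mathcal M$ continuous on $Y$ such that $\mathrm{supp}(q_x)\supset B_{\rho_0}(f(x))$ and $\underline q\le q_x\le\overline q$ for all $x\in Y$, and that there is a point $x_0\in\mathcal M$ such that $\{f^nx_0:n\ge 0\}$ is dense in $\mathcal M$ and contained in $Y$. Then the Markov chain with transition probabilities $(p_x)_{x\in\mathcal M}$ has a unique stationary probability measure $\mu$, and it has exponential decay of correlations against $L^1$ observables: there are constants $C>0$ and $\lambda>1$ such that for all $\phi\in L^\infty(\mathrm{Leb})$, all $\psi\in L^1(\mathrm{Leb})$ and all $n\ge1$, $$\left|\int\left(\int\psi\,dp^n_x\right)\phi(x)\,d\mu(x)-\int\phi\,d\mu\int\psi\,d\mu\right|\le C\lambda^{-n}\,\|\phi\|_{L^\infty(\mathrm{Leb})}\,\|\psi\|_{L^1(\mathrm{Leb})}.$$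
   Context: $\mathcal M$ is a compact connected finite-dimensional Riemannian manifold with induced Riemannian distance, Borel $\sigma$-algebra $\mathcal B$ and normalised volume (probability) measure $\mathrm{Leb}$. $B_r(x)$ is the open ball of radius $r$ about $x$. $p^n_x$ denotes the $n$-step transition probability of the chain: $p^1_x=p_x$ and $p^{n+1}_x(A)=\int p_y(A)\,dp^n_x(y)$. A probability measure $\mu$ on $\mathcal B$ is stationary if $\int p_x(A)\,d\mu(x)=\mu(A)$ for all $A\in\mathcal B$. *)

theory Defs
  imports "HOL-Probability.Probability"
begin

section \<open>Riemannian manifolds\<close>

text \<open>
  A manifold is a type \<open>'a\<close> of class \<open>metric_space\<close> together with an atlas. A chart is a pair
  \<open>(U, \<phi>)\<close> of a domain and a coordinate map; the values of \<open>\<phi>\<close> outside \<open>U\<close> are irrelevant.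
\<close>

type_synonym ('a, 'n) chart = "'a set \<times> ('a \<Rightarrow> real^'n)"

primrec Ck_on ::
  "nat \<Rightarrow> 'a::euclidean_space set \<Rightarrow> ('a \<Rightarrow> 'b::real_normed_vector) \<Rightarrow> bool" where
  "Ck_on 0 S f \<longleftrightarrow> continuous_on S f"
| "Ck_on (Suc k) S f \<longleftrightarrow>
     (\<forall>x\<in>S. f differentiable (at x)) \<and>
     (\<forall>b\<in>Basis. Ck_on k S (\<lambda>x. frechet_derivative f (at x) b))"

definition smooth_on ::
  "'a::euclidean_space set \<Rightarrow> ('a \<Rightarrow> 'b::real_normed_vector) \<Rightarrow> bool" where
  "smooth_on S f \<longleftrightarrow> (\<forall>k. Ck_on k S f)"

definition chart_inv :: "('a, 'n) chart \<Rightarrow> real^'n \<Rightarrow> 'a" where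
  "chart_inv c = inv_into (fst c) (snd c)"

definition transition :: "('a, 'n) chart \<Rightarrow> ('a, 'n) chart \<Rightarrow> real^'n \<Rightarrow> real^'n" where
  "transition c d = snd d \<circ> chart_inv c"

definition is_chart :: "('a::metric_space, 'n::finite) chart \<Rightarrow> bool" where
  "is_chart c \<longleftrightarrow> open (fst c) \<and> open (snd c ` fst c) \<and>
     homeomorphism (fst c) (snd c ` fst c) (snd c) (chart_inv c)"

definition smooth_atlas :: "('a::metric_space, 'n::finite) chart set \<Rightarrow> bool" where
  "smooth_atlas \<A> \<longleftrightarrow>
     (\<forall>c\<in>\<A>. is_chart c) \<and> (\<Union>c\<in>\<A>. fst c) = UNIV \<and>
     (\<forall>c\<in>\<A>. \<forall>d\<in>\<A>. smooth_on (snd c ` (fst c \<inter> fst d)) (transition c d))"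

text \<open>
  A Riemannian metric is given by its Gram matrices: \<open>g c x $ i $ j\<close> is the inner product at \<open>x\<close>
  of the \<open>i\<close>-th and \<open>j\<close>-th coordinate vector fields of the chart \<open>c\<close>. The last condition is the
  transformation law of a covariant 2-tensor.
\<close>

definition riemannian_metric ::
  "('a::metric_space, 'n::finite) chart set \<Rightarrow> (('a, 'n) chart \<Rightarrow> 'a \<Rightarrow> real^'n^'n) \<Rightarrow> bool" where
  "riemannian_metric \<A> g \<longleftrightarrow>
     (\<forall>c\<in>\<A>. \<forall>x\<in>fst c. transpose (g c x) = g c x \<and> (\<forall>v. v \<noteq> 0 \<longrightarrow> v \<bullet> (g c x *v v) > 0)) \<and>
     (\<forall>c\<in>\<A>. \<forall>i j. smooth_on (snd c ` fst c) (\<lambda>z. g c (chart_inv c z) $ i $ j)) \<and>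
     (\<forall>c\<in>\<A>. \<forall>d\<in>\<A>. \<forall>x\<in>fst c \<inter> fst d.
        let J = jacobian (transition c d) (at (snd c x))
        in g c x = transpose J ** g d x ** J)"

definition C1_arc ::
  "('a::metric_space, 'n::finite) chart set \<Rightarrow> real \<Rightarrow> real \<Rightarrow> (real \<Rightarrow> 'a) \<Rightarrow> bool" where
  "C1_arc \<A> a b \<gamma> \<longleftrightarrow> continuous_on {a..b} \<gamma> \<and>
     (\<forall>c\<in>\<A>. \<exists>D. continuous_on {t\<in>{a..b}. \<gamma> t \<in> fst c} D \<and>
        (\<forall>t\<in>{a..b}. \<gamma> t \<in> fst c \<longrightarrow>
           ((snd c \<circ> \<gamma>) has_vector_derivative D t) (at t within {a..b})))"

definition piecewise_C1_curve ::
  "('a::metric_space, 'n::finite) chart set \<Rightarrow> (real \<Rightarrow> 'a) \<Rightarrow> bool" where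
  "piecewise_C1_curve \<A> \<gamma> \<longleftrightarrow>
     (\<exists>(m::nat) \<tau>. \<tau> 0 = 0 \<and> \<tau> m = 1 \<and>
        (\<forall>i<m. \<tau> i < \<tau> (Suc i) \<and> C1_arc \<A> (\<tau> i) (\<tau> (Suc i)) \<gamma>))"

text \<open>
  By the transformation law the speed does not depend on the chart chosen around \<open>\<gamma> t\<close>. For a
  piecewise \<open>C\<^sup>1\<close> curve its value is meaningless at the finitely many break points and at the two
  end points, which does not affect the length.
\<close>

definition speed ::
  "('a::metric_space, 'n::finite) chart set \<Rightarrow> (('a, 'n) chart \<Rightarrow> 'a \<Rightarrow> real^'n^'n)
     \<Rightarrow> (real \<Rightarrow> 'a) \<Rightarrow> real \<Rightarrow> real" where
  "speed \<A> g \<gamma> t =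
     (let c = (SOME c. c \<in> \<A> \<and> \<gamma> t \<in> fst c); v = vector_derivative (snd c \<circ> \<gamma>) (at t)
      in sqrt (v \<bullet> (g c (\<gamma> t) *v v)))"

definition curve_length ::
  "('a::metric_space, 'n::finite) chart set \<Rightarrow> (('a, 'n) chart \<Rightarrow> 'a \<Rightarrow> real^'n^'n)
     \<Rightarrow> (real \<Rightarrow> 'a) \<Rightarrow> real" where
  "curve_length \<A> g \<gamma> = integral {0..1} (speed \<A> g \<gamma>)"

definition riemannian_dist ::
  "('a::metric_space, 'n::finite) chart set \<Rightarrow> (('a, 'n) chart \<Rightarrow> 'a \<Rightarrow> real^'n^'n)
     \<Rightarrow> 'a \<Rightarrow> 'a \<Rightarrow> real" where
  "riemannian_dist \<A> g x y =
     Inf (curve_length \<A> g ` {\<gamma>. piecewise_C1_curve \<A> \<gamma> \<and> \<gamma> 0 = x \<and> \<gamma> 1 = y})"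

text \<open>
  The condition determines the Riemannian volume uniquely, since countably many charts cover the
  (second countable) manifold.
\<close>

definition riemannian_volume ::
  "('a::metric_space, 'n::finite) chart set \<Rightarrow> (('a, 'n) chart \<Rightarrow> 'a \<Rightarrow> real^'n^'n)
     \<Rightarrow> 'a measure \<Rightarrow> bool" where
  "riemannian_volume \<A> g vol \<longleftrightarrow> sets vol = sets borel \<and>
     (\<forall>c\<in>\<A>. \<forall>B\<in>sets borel. B \<subseteq> fst c \<longrightarrow>
        emeasure vol B = (\<integral>\<^sup>+z\<in>snd c ` B. ennreal (sqrt (det (g c (chart_inv c z)))) \<partial>lborel))"

text \<open>
  In a compact connected Riemannian manifold the distance of the type is the induced Riemannian
  distance.
\<close>

definition compact_connected_riemannian_manifold ::
  "('a::metric_space, 'n::finite) chart set \<Rightarrow> (('a, 'n) chart \<Rightarrow> 'a \<Rightarrow> real^'n^'n) \<Rightarrow> bool" where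
  "compact_connected_riemannian_manifold \<A> g \<longleftrightarrow>
     compact (UNIV :: 'a set) \<and> connected (UNIV :: 'a set) \<and>
     smooth_atlas \<A> \<and> riemannian_metric \<A> g \<and>
     (\<forall>x y. dist x y = riemannian_dist \<A> g x y)"


section \<open>Function spaces\<close>

definition holder_continuous :: "real \<Rightarrow> ('a::metric_space \<Rightarrow> real) \<Rightarrow> bool" where
  "holder_continuous \<alpha> h \<longleftrightarrow> (\<exists>H\<ge>0. \<forall>x y. \<bar>h x - h y\<bar> \<le> H * dist x y powr \<alpha>)"

definition Linfty :: "'a measure \<Rightarrow> ('a \<Rightarrow> real) set" where
  "Linfty M = {h \<in> borel_measurable M. esssup M (\<lambda>x. ereal \<bar>h x\<bar>) < \<infinity>}"

definition Linfty_norm :: "'a measure \<Rightarrow> ('a \<Rightarrow> real) \<Rightarrow> real" where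
  "Linfty_norm M h = real_of_ereal (esssup M (\<lambda>x. ereal \<bar>h x\<bar>))"

definition L1_norm :: "'a measure \<Rightarrow> ('a \<Rightarrow> real) \<Rightarrow> real" where
  "L1_norm M h = (\<integral>x. \<bar>h x\<bar> \<partial>M)"


section \<open>Markov chains\<close>

definition weakly_continuous :: "('a::metric_space \<Rightarrow> 'a measure) \<Rightarrow> bool" where
  "weakly_continuous p \<longleftrightarrow>
     (\<forall>h :: 'a \<Rightarrow> real. continuous_on UNIV h \<and> bounded (range h) \<longrightarrow>
        continuous_on UNIV (\<lambda>x. \<integral>y. h y \<partial>p x))"

text \<open>
  By \<open>emeasure_bind\<close>, the measure \<open>bind M p\<close> of a set \<open>A\<close> is the integral of \<open>p y A\<close> over \<open>M\<close>
  whenever the kernel \<open>p\<close> is measurable, in particular when it is weakly continuous.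
\<close>

fun n_step :: "('a::topological_space \<Rightarrow> 'a measure) \<Rightarrow> nat \<Rightarrow> 'a \<Rightarrow> 'a measure" where
  "n_step p 0 x = return borel x"
| "n_step p (Suc 0) x = p x"
| "n_step p (Suc (Suc n)) x = bind (n_step p (Suc n) x) p"

definition stationary :: "('a::topological_space \<Rightarrow> 'a measure) \<Rightarrow> 'a measure \<Rightarrow> bool" where
  "stationary p \<mu> \<longleftrightarrow> prob_space \<mu> \<and> sets \<mu> = sets borel \<and>
     (\<forall>A\<in>sets borel. (\<integral>\<^sup>+x. emeasure (p x) A \<partial>\<mu>) = emeasure \<mu> A)"

end

theory Submission
  imports Defs
begin

text \<open>
  The orbit of \<open>x0\<close> lies in \<open>Y\<close> and is dense, so \<open>Y\<close> is dense; as \<open>x \<mapsto> q x y\<close> is continuous,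
  the bounds \<open>qlow \<le> q x y \<le> qup\<close> hold for all \<open>x\<close> and \<open>y\<close>. Hence the chain satisfies Doeblin's
  condition in one step: with \<open>0 < \<delta> \<le> qlow\<close> and \<open>\<delta> < 1\<close>, every transition probability splits as
  \<open>p x = \<delta> Leb + (1 - \<delta>) r x\<close> for a Markov kernel \<open>r\<close>, the residual kernel: with probability
  \<open>\<delta>\<close> the chain forgets its position and restarts from \<open>Leb\<close>.

  The \<open>Leb\<close>-part of \<open>\<integral>h dp x\<close> does not depend on \<open>x\<close>, so one step of the chain multiplies the
  oscillation of a bounded function by at most \<open>1 - \<delta>\<close> (\<open>kernel_contracts_oscillation\<close>). An
  integrable \<open>\<psi>\<close> may be unbounded, but its mean \<open>\<integral>\<psi> dp x\<close> after one step is bounded by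
  \<open>qup * L1_norm Leb \<psi>\<close>; so the first step is spent on passing from \<open>L\<^sup>1\<close> to bounded functions and
  the others contract. Integrating against a stationary \<open>\<nu>\<close>, which does not change under the
  chain, shows that \<open>\<integral>\<psi> dp\<^sup>n x\<close> is within \<open>(1 - \<delta>) ^ (n - 1) * 2 * qup * L1_norm Leb \<psi>\<close> of
  \<open>\<integral>\<psi> d\<nu>\<close>, uniformly in \<open>x\<close> (\<open>n_step_converges_to_stationary\<close>). Uniqueness of the stationary
  measure is immediate from this limit. Decay of correlations follows on multiplying by \<open>\<phi>\<close> and
  integrating, since \<open>\<nu>\<close> is absolutely continuous and so \<open>\<bar>\<phi>\<bar> \<le> Linfty_norm Leb \<phi>\<close> almost
  everywhere for \<open>\<nu>\<close>.

  A stationary measure is obtained by looking backwards from a time in the distant past: the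
  number of steps since the last restart is geometrically distributed, and between restarts the
  chain moves by \<open>r\<close>. This gives \<open>\<mu> = (\<Sum>k. \<delta> * (1 - \<delta>) ^ k * Leb r\<^sup>k)\<close>
  (\<open>stationary_regeneration_measure\<close>).
\<close>

section \<open>Integration against Markov kernels\<close>

lemma in_prob_algebraD:
  assumes "M \<in> space (prob_algebra N)"
  shows "prob_space M" "sets M = sets N" "space M = space N"
  using assms by (auto simp: space_prob_algebra dest: sets_eq_imp_space_eq)

text \<open>
  A uniform \<open>L\<^sup>1\<close> bound for the function under the kernel replaces boundedness of the function
  itself; this is what lets unbounded observables be treated. The identity is
  \<open>nn_integral_bind\<close> applied to positive and negative parts, whose means \<open>u\<close> and \<open>v\<close> are bounded.
\<close>

lemma integral_bind_kernel:
  fixes h :: "'b \<Rightarrow> real"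
  assumes M: "M \<in> space (prob_algebra S)" and K: "K \<in> S \<rightarrow>\<^sub>M prob_algebra N"
    and h [measurable]: "h \<in> borel_measurable N"
    and bound: "\<And>y. y \<in> space S \<Longrightarrow> (\<integral>\<^sup>+z. ennreal \<bar>h z\<bar> \<partial>K y) \<le> ennreal c"
  shows "integrable (bind M K) h"
    and "(\<integral>z. h z \<partial>bind M K) = (\<integral>y. (\<integral>z. h z \<partial>K y) \<partial>M)"
proof -
  interpret M: prob_space M
    using in_prob_algebraD[OF M] by simp
  have sM: "sets M = sets S" "space M = space S"
    using in_prob_algebraD[OF M] by auto
  have K' [measurable]: "K \<in> M \<rightarrow>\<^sub>M subprob_algebra N"
    using K by (simp add: measurable_prob_algebraD sM cong: measurable_cong_sets)
  have sK: "sets (K y) = sets N" if "y \<in> space S" for y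
    using that measurable_space[OF K that] by (simp add: space_prob_algebra)
  have sB: "sets (bind M K) = sets N"
    using M K by (rule sets_bind')
  have hB [measurable]: "h \<in> borel_measurable (bind M K)"
    using h by (simp add: sB cong: measurable_cong_sets)
  have hK: "h \<in> borel_measurable (K y)" if "y \<in> space S" for y
    using h by (simp add: sK[OF that] cong: measurable_cong_sets)
  have le: "(\<integral>\<^sup>+y. \<integral>\<^sup>+z. ennreal \<bar>h z\<bar> \<partial>K y \<partial>M) \<le> (\<integral>\<^sup>+y. ennreal c \<partial>M)"
    by (rule nn_integral_mono) (simp add: bound sM)
  then have le': "(\<integral>\<^sup>+y. \<integral>\<^sup>+z. ennreal \<bar>h z\<bar> \<partial>K y \<partial>M) \<le> ennreal c"
    by (simp add: M.emeasure_space_1)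
  have bind_eq: "(\<integral>\<^sup>+z. k z \<partial>bind M K) = (\<integral>\<^sup>+y. \<integral>\<^sup>+z. k z \<partial>K y \<partial>M)"
    if "k \<in> borel_measurable N" for k
    by (rule nn_integral_bind[OF that K'])
  show int: "integrable (bind M K) h"
  proof (rule integrableI_bounded)
    have "(\<integral>\<^sup>+z. ennreal (norm (h z)) \<partial>bind M K) \<le> ennreal c"
      using le' by (simp add: bind_eq)
    then show "(\<integral>\<^sup>+z. ennreal (norm (h z)) \<partial>bind M K) < \<infinity>"
      by (simp add: le_less_trans)
  qed simp
  define u v where "u = (\<lambda>y. \<integral>\<^sup>+z. ennreal (h z) \<partial>K y)"
    and "v = (\<lambda>y. \<integral>\<^sup>+z. ennreal (- h z) \<partial>K y)"
  have u_le: "u y \<le> ennreal c" if "y \<in> space S" for y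
    unfolding u_def
    by (rule order_trans[OF nn_integral_mono bound[OF that]]) (simp add: ennreal_leI)
  have v_le: "v y \<le> ennreal c" if "y \<in> space S" for y
    unfolding v_def
    by (rule order_trans[OF nn_integral_mono bound[OF that]]) (simp add: ennreal_leI)
  have [measurable]: "u \<in> borel_measurable M" "v \<in> borel_measurable M"
    unfolding u_def v_def by measurable
  have fin: "integrable M (\<lambda>y. enn2real (w y))"
      "(\<integral>y. enn2real (w y) \<partial>M) = enn2real (\<integral>\<^sup>+y. w y \<partial>M)"
    if w [measurable]: "w \<in> borel_measurable M" and "\<And>y. y \<in> space S \<Longrightarrow> w y \<le> ennreal c" for w
  proof -
    have ennw: "ennreal (enn2real (w y)) = w y" if "y \<in> space M" for y
      using that \<open>\<And>y. y \<in> space S \<Longrightarrow> w y \<le> ennreal c\<close>[of y]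
      by (simp add: sM le_less_trans[OF _ ennreal_less_top])
    have "(\<integral>\<^sup>+y. w y \<partial>M) \<le> (\<integral>\<^sup>+y. ennreal c \<partial>M)"
      by (rule nn_integral_mono) (simp add: that sM)
    then have "(\<integral>\<^sup>+y. w y \<partial>M) < \<infinity>"
      by (simp add: M.emeasure_space_1 le_less_trans[OF _ ennreal_less_top])
    moreover have "(\<integral>\<^sup>+y. ennreal (enn2real (w y)) \<partial>M) = (\<integral>\<^sup>+y. w y \<partial>M)"
      by (rule nn_integral_cong) (rule ennw)
    ultimately show "integrable M (\<lambda>y. enn2real (w y))"
      "(\<integral>y. enn2real (w y) \<partial>M) = enn2real (\<integral>\<^sup>+y. w y \<partial>M)"
      by (auto simp: integrable_iff_bounded integral_eq_nn_integral)
  qed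
  have hKy: "(\<integral>z. h z \<partial>K y) = enn2real (u y) - enn2real (v y)" if "y \<in> space S" for y
  proof -
    have "integrable (K y) h"
      using bound[OF that] hK[OF that]
      by (auto intro!: integrableI_bounded simp: le_less_trans[OF _ ennreal_less_top])
    then show ?thesis
      by (simp add: real_lebesgue_integral_def u_def v_def)
  qed
  have "(\<integral>z. h z \<partial>bind M K) = enn2real (\<integral>\<^sup>+y. u y \<partial>M) - enn2real (\<integral>\<^sup>+y. v y \<partial>M)"
    by (simp add: real_lebesgue_integral_def[OF int] bind_eq u_def v_def)
  also have "\<dots> = (\<integral>y. enn2real (u y) - enn2real (v y) \<partial>M)"
    by (simp add: fin u_le v_le)
  also have "\<dots> = (\<integral>y. (\<integral>z. h z \<partial>K y) \<partial>M)"
    by (rule Bochner_Integration.integral_cong) (simp_all add: hKy sM)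
  finally show "(\<integral>z. h z \<partial>bind M K) = (\<integral>y. (\<integral>z. h z \<partial>K y) \<partial>M)" .
qed

lemma nn_integral_abs_le_of_bounded:
  assumes "prob_space M" "\<And>x. \<bar>h x\<bar> \<le> (c::real)"
  shows "(\<integral>\<^sup>+x. ennreal \<bar>h x\<bar> \<partial>M) \<le> ennreal c"
proof -
  interpret prob_space M by fact
  have "(\<integral>\<^sup>+x. ennreal \<bar>h x\<bar> \<partial>M) \<le> (\<integral>\<^sup>+x. ennreal c \<partial>M)"
    by (intro nn_integral_mono ennreal_leI assms)
  then show ?thesis
    by (simp add: emeasure_space_1)
qed

lemma integrable_bounded:
  assumes "prob_space M" "sets M = sets N" "h \<in> borel_measurable N" "\<And>x. \<bar>h x\<bar> \<le> (c::real)"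
  shows "integrable M h"
proof -
  interpret prob_space M by fact
  show ?thesis
    using assms by (intro integrable_const_bound[where B = c]) (auto cong: measurable_cong_sets)
qed

lemma (in prob_space) abs_integral_diff_const_le:
  fixes h :: "'a \<Rightarrow> real"
  assumes "integrable M h" and "\<And>x. \<bar>h x - c\<bar> \<le> D"
  shows "\<bar>(\<integral>x. h x \<partial>M) - c\<bar> \<le> D"
proof -
  have "(\<integral>x. h x \<partial>M) - c = (\<integral>x. h x - c \<partial>M)"
    using assms by (simp add: prob_space)
  also have "\<bar>\<dots>\<bar> \<le> (\<integral>x. \<bar>h x - c\<bar> \<partial>M)"
    by (rule integral_abs_bound)
  also have "\<dots> \<le> (\<integral>x. D \<partial>M)"
    using assms by (intro integral_mono) auto
  finally show ?thesis
    by (simp add: prob_space)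
qed

text \<open>
  Both integrals are averages of values of \<open>h\<close>, so they are as close as any two such values.
\<close>

lemma abs_integral_diff_le_oscillation:
  fixes h :: "'a \<Rightarrow> real"
  assumes "prob_space M" "prob_space N" "integrable M h" "integrable N h"
    and osc: "\<And>x y. \<bar>h x - h y\<bar> \<le> D"
  shows "\<bar>(\<integral>x. h x \<partial>M) - (\<integral>x. h x \<partial>N)\<bar> \<le> D"
proof -
  have "\<bar>h y - (\<integral>x. h x \<partial>M)\<bar> \<le> D" for y
    using prob_space.abs_integral_diff_const_le[OF assms(1,3), of "h y" D] osc[of _ y]
    by (simp only: abs_minus_commute[of "h y"])
  then have "\<bar>(\<integral>y. h y \<partial>N) - (\<integral>x. h x \<partial>M)\<bar> \<le> D"
    by (rule prob_space.abs_integral_diff_const_le[OF assms(2,4)])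
  then show ?thesis
    by (simp only: abs_minus_commute)
qed

text \<open>
  The recursion in the definition starts at \<open>n = 1\<close>; it extends to \<open>n = 0\<close> because the Dirac
  kernel is a left unit for \<open>bind\<close>. This gives plain induction on \<open>n\<close>.
\<close>

lemma n_step_Suc:
  assumes "p \<in> borel \<rightarrow>\<^sub>M prob_algebra borel"
  shows "n_step p (Suc n) x = bind (n_step p n x) p"
  using assms by (cases n) (simp_all add: bind_return[OF measurable_prob_algebraD])

lemma measurable_n_step:
  assumes p: "p \<in> borel \<rightarrow>\<^sub>M prob_algebra borel"
  shows "n_step p n \<in> borel \<rightarrow>\<^sub>M prob_algebra borel"
proof (induction n)
  case 0
  have "n_step p 0 = return borel"
    by (rule ext) simp
  then show ?case
    by simp
next
  case (Suc n)
  have "n_step p (Suc n) = (\<lambda>x. bind (n_step p n x) p)"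
    by (rule ext) (rule n_step_Suc[OF p])
  then show ?case
    using measurable_bind_prob_space[OF Suc p] by simp
qed

lemma n_step_in_prob_algebra:
  assumes "p \<in> borel \<rightarrow>\<^sub>M prob_algebra borel"
  shows "n_step p n x \<in> space (prob_algebra borel)"
  using measurable_space[OF measurable_n_step[OF assms]] by simp

lemma stationary_bind_eq:
  assumes p: "p \<in> borel \<rightarrow>\<^sub>M prob_algebra borel" and \<nu>: "stationary p \<nu>"
  shows "bind \<nu> p = \<nu>"
proof (rule measure_eqI)
  have \<nu>': "\<nu> \<in> space (prob_algebra borel)"
    using \<nu> by (simp add: stationary_def space_prob_algebra)
  show sets: "sets (bind \<nu> p) = sets \<nu>"
    using sets_bind'[OF \<nu>' p] \<nu> by (simp add: stationary_def)
  fix A assume "A \<in> sets (bind \<nu> p)"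
  then have "A \<in> sets borel"
    using sets_bind'[OF \<nu>' p] by simp
  then show "emeasure (bind \<nu> p) A = emeasure \<nu> A"
    using emeasure_bind_prob_algebra[OF \<nu>' p] \<nu> by (simp add: stationary_def)
qed

lemma stationary_bind_n_step_eq:
  assumes p: "p \<in> borel \<rightarrow>\<^sub>M prob_algebra borel" and \<nu>: "stationary p \<nu>"
  shows "bind \<nu> (n_step p n) = \<nu>"
proof (induction n)
  case 0
  have "n_step p 0 = return borel"
    by (rule ext) simp
  then show ?case
    using \<nu> by (simp add: stationary_def bind_return'')
next
  case (Suc n)
  have m: "n_step p n \<in> \<nu> \<rightarrow>\<^sub>M subprob_algebra borel"
    using measurable_prob_algebraD[OF measurable_n_step[OF p]] \<nu>
    by (simp add: stationary_def cong: measurable_cong_sets)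
  have "bind \<nu> (n_step p (Suc n)) = bind \<nu> (\<lambda>x. bind (n_step p n x) p)"
    by (rule arg_cong[where f = "bind \<nu>"]) (rule ext, rule n_step_Suc[OF p])
  also have "\<dots> = bind (bind \<nu> (n_step p n)) p"
    by (rule bind_assoc[OF m measurable_prob_algebraD[OF p], symmetric])
  also have "\<dots> = \<nu>"
    by (simp add: Suc stationary_bind_eq[OF p \<nu>])
  finally show ?case .
qed

section \<open>Chains with a bounded density that is bounded away from zero\<close>

locale doeblin_chain =
  fixes L :: "'a::topological_space measure" and p :: "'a \<Rightarrow> 'a measure"
    and q :: "'a \<Rightarrow> 'a \<Rightarrow> real" and \<delta> b :: real
  assumes reference: "L \<in> space (prob_algebra borel)"
    and kernel [measurable]: "p \<in> borel \<rightarrow>\<^sub>M prob_algebra borel"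
    and density_measurable [measurable]: "q x \<in> borel_measurable borel"
    and kernel_density: "p x = density L (\<lambda>y. ennreal (q x y))"
    and lower: "\<delta> \<le> q x y" and upper: "q x y \<le> b"
    and delta: "0 < \<delta>" "\<delta> < 1"
begin

sublocale L: prob_space L
  using in_prob_algebraD[OF reference] by simp

lemma sets_L [measurable_cong, simp]: "sets L = sets borel"
  using in_prob_algebraD[OF reference] by simp

lemma q_pos: "0 < q x y"
  using lower[of x y] delta by simp

lemma b_pos: "0 < b"
  using q_pos upper by (rule less_le_trans)

lemma kernel_in: "p x \<in> space (prob_algebra borel)"
  using measurable_space[OF kernel] by simp

lemma prob_space_kernel: "prob_space (p x)"
  using in_prob_algebraD[OF kernel_in] by simp

lemma sets_kernel [simp]: "sets (p x) = sets borel"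
  using in_prob_algebraD[OF kernel_in] by simp

text \<open>
  What remains of the transition probabilities, renormalised to mass one, after the part
  \<open>\<delta> L\<close> common to all of them has been removed.
\<close>

definition residual :: "'a \<Rightarrow> 'a measure" where
  "residual x = density L (\<lambda>y. ennreal ((q x y - \<delta>) / (1 - \<delta>)))"

lemma sets_residual [simp]: "sets (residual x) = sets borel"
  by (simp add: residual_def)

lemma nn_integral_kernel_split:
  assumes h [measurable]: "h \<in> borel_measurable borel"
  shows "(\<integral>\<^sup>+y. h y \<partial>p x) =
    ennreal \<delta> * (\<integral>\<^sup>+y. h y \<partial>L) + ennreal (1 - \<delta>) * (\<integral>\<^sup>+y. h y \<partial>residual x)"
proof -
  have split: "ennreal (q x y) = ennreal \<delta> + ennreal (1 - \<delta>) * ennreal ((q x y - \<delta>) / (1 - \<delta>))"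
    for y
  proof -
    have "ennreal (1 - \<delta>) * ennreal ((q x y - \<delta>) / (1 - \<delta>)) = ennreal (q x y - \<delta>)"
      using lower[of x y] delta by (simp add: ennreal_mult[symmetric])
    then show ?thesis
      using lower[of x y] delta by (simp add: ennreal_plus[symmetric] del: ennreal_plus)
  qed
  have "(\<integral>\<^sup>+y. h y \<partial>p x) = (\<integral>\<^sup>+y. ennreal (q x y) * h y \<partial>L)"
    by (simp add: kernel_density nn_integral_density)
  also have "\<dots> = (\<integral>\<^sup>+y. ennreal \<delta> * h y +
      ennreal (1 - \<delta>) * (ennreal ((q x y - \<delta>) / (1 - \<delta>)) * h y) \<partial>L)"
    by (rule nn_integral_cong) (simp add: split ring_distribs mult.assoc)
  also have "\<dots> = ennreal \<delta> * (\<integral>\<^sup>+y. h y \<partial>L) + ennreal (1 - \<delta>) * (\<integral>\<^sup>+y. h y \<partial>residual x)"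
    by (simp add: nn_integral_add nn_integral_cmult residual_def nn_integral_density)
  finally show ?thesis .
qed

lemma emeasure_kernel_split:
  assumes "A \<in> sets borel"
  shows "emeasure (p x) A = ennreal \<delta> * emeasure L A + ennreal (1 - \<delta>) * emeasure (residual x) A"
  using nn_integral_kernel_split[of "indicator A" x] assms by simp

lemma prob_space_residual: "prob_space (residual x)"
proof
  have "1 = ennreal \<delta> + ennreal (1 - \<delta>) * emeasure (residual x) UNIV"
    using emeasure_kernel_split[of UNIV x] prob_space.emeasure_space_1[OF prob_space_kernel[of x]]
      L.emeasure_space_1 by (simp add: sets_eq_imp_space_eq[of "p x" borel] sets_eq_imp_space_eq[of L borel])
  moreover have "(1::ennreal) = ennreal \<delta> + ennreal (1 - \<delta>)"
    using delta by (simp add: ennreal_plus[symmetric] del: ennreal_plus)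
  ultimately have "ennreal (1 - \<delta>) * emeasure (residual x) UNIV = ennreal (1 - \<delta>) * 1"
    by (metis ennreal_add_left_cancel ennreal_neq_top mult.right_neutral infinity_ennreal_def)
  then have "emeasure (residual x) UNIV = 1"
    using delta by (subst (asm) ennreal_mult_cancel_left) auto
  then show "emeasure (residual x) (space (residual x)) = 1"
    by (simp add: sets_eq_imp_space_eq[of "residual x" borel])
qed

text \<open>
  Measurability is inherited from \<open>p\<close> by solving the splitting for \<open>residual x\<close>. Its
  density gives no direct argument, as \<open>q\<close> need not be jointly measurable.
\<close>

lemma residual_measurable [measurable]: "residual \<in> borel \<rightarrow>\<^sub>M prob_algebra borel"
proof (rule measurable_prob_algebraI[OF prob_space_residual measurable_subprob_algebra])
  fix A :: "'a set" assume A [measurable]: "A \<in> sets borel"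
  have "emeasure (residual x) A = (emeasure (p x) A - ennreal \<delta> * emeasure L A) / ennreal (1 - \<delta>)" for x
  proof -
    have "ennreal \<delta> * emeasure L A \<noteq> \<infinity>"
      by (simp add: ennreal_mult_eq_top_iff)
    then have "emeasure (p x) A - ennreal \<delta> * emeasure L A = ennreal (1 - \<delta>) * emeasure (residual x) A"
      by (simp add: emeasure_kernel_split)
    then show ?thesis
      using delta by (simp add: ennreal_mult_divide_eq mult.commute[of "ennreal (1 - \<delta>)"])
  qed
  moreover have "(\<lambda>x. (emeasure (p x) A - ennreal \<delta> * emeasure L A) / ennreal (1 - \<delta>)) \<in> borel_measurable borel"
    using measurable_prob_algebraD[OF kernel] by measurable
  ultimately show "(\<lambda>x. emeasure (residual x) A) \<in> borel_measurable borel"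
    by simp
qed (simp_all add: prob_space_residual prob_space_imp_subprob_space)

lemma integral_kernel_split:
  assumes h [measurable]: "h \<in> borel_measurable borel" and c: "\<And>x. \<bar>h x\<bar> \<le> (c::real)"
  shows "(\<integral>y. h y \<partial>p x) = \<delta> * (\<integral>y. h y \<partial>L) + (1 - \<delta>) * (\<integral>y. h y \<partial>residual x)"
proof -
  have iL: "integrable L h" and ip: "integrable (p x) h"
    by (rule integrable_bounded[OF _ _ h c]; simp add: L.prob_space_axioms prob_space_kernel)+
  have "integrable L (\<lambda>y. q x y * h y)"
    using ip q_pos by (subst (asm) kernel_density) (simp add: integrable_real_density less_imp_le)
  then have "(\<integral>y. q x y * h y - \<delta> * h y \<partial>L) = (\<integral>y. q x y * h y \<partial>L) - \<delta> * (\<integral>y. h y \<partial>L)"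
    using iL by simp
  moreover have "(\<integral>y. h y \<partial>p x) = (\<integral>y. q x y * h y \<partial>L)"
    unfolding kernel_density using q_pos by (simp add: integral_real_density less_imp_le)
  moreover have "(1 - \<delta>) * (\<integral>y. h y \<partial>residual x) = (\<integral>y. q x y * h y - \<delta> * h y \<partial>L)"
  proof -
    have "(\<integral>y. h y \<partial>residual x) = (\<integral>y. (q x y - \<delta>) / (1 - \<delta>) * h y \<partial>L)"
      unfolding residual_def using lower delta by (simp add: integral_real_density)
    also have "(1 - \<delta>) * \<dots> = (\<integral>y. (1 - \<delta>) * ((q x y - \<delta>) / (1 - \<delta>) * h y) \<partial>L)"
      by simp
    also have "\<dots> = (\<integral>y. (q x y - \<delta>) * h y \<partial>L)"
      using delta by simp
    also have "\<dots> = (\<integral>y. q x y * h y - \<delta> * h y \<partial>L)"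
      by (simp add: left_diff_distrib)
    finally show ?thesis .
  qed
  ultimately show ?thesis
    by simp
qed

text \<open>
  The terms \<open>\<delta> * \<integral>h dL\<close> cancel in the difference, and what is left is \<open>1 - \<delta>\<close> times a difference
  of means of \<open>h\<close> under probability measures.
\<close>

lemma kernel_contracts_oscillation:
  assumes h: "h \<in> borel_measurable borel" and c: "\<And>x. \<bar>h x\<bar> \<le> (c::real)"
    and osc: "\<And>x y. \<bar>h x - h y\<bar> \<le> D"
  shows "\<bar>(\<integral>z. h z \<partial>p x) - (\<integral>z. h z \<partial>p y)\<bar> \<le> (1 - \<delta>) * D"
proof -
  have "(\<integral>z. h z \<partial>p x) - (\<integral>z. h z \<partial>p y) =
      (1 - \<delta>) * ((\<integral>z. h z \<partial>residual x) - (\<integral>z. h z \<partial>residual y))"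
    unfolding integral_kernel_split[OF h c] by (simp add: algebra_simps)
  moreover have "\<bar>(\<integral>z. h z \<partial>residual x) - (\<integral>z. h z \<partial>residual y)\<bar> \<le> D"
    by (intro abs_integral_diff_le_oscillation osc integrable_bounded[OF _ _ h c])
      (simp_all add: prob_space_residual)
  ultimately show ?thesis
    using delta by (simp add: abs_mult)
qed

text \<open>
  The last of the \<open>n + 1\<close> steps is absorbed into the observable, which becomes \<open>y \<mapsto> \<integral>h dp y\<close>; hence
  the induction has to be over all observables.
\<close>

lemma n_step_contracts_oscillation:
  assumes "h \<in> borel_measurable borel" and "\<And>x. \<bar>h x\<bar> \<le> (c::real)"
    and "\<And>x y. \<bar>h x - h y\<bar> \<le> D"
  shows "\<bar>(\<integral>z. h z \<partial>n_step p n x) - (\<integral>z. h z \<partial>n_step p n y)\<bar> \<le> (1 - \<delta>) ^ n * D"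
  using assms
proof (induction n arbitrary: h D)
  case 0
  then show ?case by (simp add: integral_return)
next
  case (Suc n)
  note h [measurable] = Suc.prems(1)
  define k where "k = (\<lambda>y. \<integral>z. h z \<partial>p y)"
  have k_meas: "k \<in> borel_measurable borel"
    unfolding k_def using measurable_prob_algebraD[OF kernel] by measurable
  have k_bound: "\<bar>k y\<bar> \<le> c" for y
    using prob_space.abs_integral_diff_const_le[OF prob_space_kernel, where h = h and c = 0 and D = c]
      Suc.prems(2) integrable_bounded[OF prob_space_kernel sets_kernel h Suc.prems(2)]
    by (simp add: k_def)
  have k_osc: "\<bar>k x - k y\<bar> \<le> (1 - \<delta>) * D" for x y
    unfolding k_def by (rule kernel_contracts_oscillation[OF Suc.prems])
  have step: "(\<integral>z. h z \<partial>n_step p (Suc n) x) = (\<integral>y. k y \<partial>n_step p n x)" for x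
    unfolding n_step_Suc[OF kernel] k_def
    by (rule integral_bind_kernel(2)[OF n_step_in_prob_algebra[OF kernel] kernel h])
      (rule nn_integral_abs_le_of_bounded[where h = h and c = c, OF prob_space_kernel Suc.prems(2)])
  show ?case
    unfolding step power_Suc2 mult.assoc by (rule Suc.IH[OF k_meas k_bound k_osc])
qed

subsection \<open>Integrable observables\<close>

lemma nn_integral_kernel_le:
  assumes h [measurable]: "h \<in> borel_measurable borel"
  shows "(\<integral>\<^sup>+y. h y \<partial>p x) \<le> ennreal b * (\<integral>\<^sup>+y. h y \<partial>L)"
proof -
  have "(\<integral>\<^sup>+y. h y \<partial>p x) = (\<integral>\<^sup>+y. ennreal (q x y) * h y \<partial>L)"
    by (simp add: kernel_density nn_integral_density)
  also have "\<dots> \<le> (\<integral>\<^sup>+y. ennreal b * h y \<partial>L)"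
    by (intro nn_integral_mono mult_right_mono ennreal_leI upper) simp
  finally show ?thesis
    by (simp add: nn_integral_cmult)
qed

lemma nn_integral_abs_kernel_le:
  assumes \<psi>: "integrable L \<psi>"
  shows "(\<integral>\<^sup>+y. ennreal \<bar>\<psi> y\<bar> \<partial>p x) \<le> ennreal (b * (\<integral>y. \<bar>\<psi> y\<bar> \<partial>L))"
proof -
  have [measurable]: "\<psi> \<in> borel_measurable borel"
    using borel_measurable_integrable[OF \<psi>] by (simp cong: measurable_cong_sets)
  have "(\<integral>\<^sup>+y. ennreal \<bar>\<psi> y\<bar> \<partial>p x) \<le> ennreal b * (\<integral>\<^sup>+y. ennreal \<bar>\<psi> y\<bar> \<partial>L)"
    by (rule nn_integral_kernel_le) simp
  also have "\<dots> = ennreal (b * (\<integral>y. \<bar>\<psi> y\<bar> \<partial>L))"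
    using \<psi> b_pos by (simp add: nn_integral_eq_integral ennreal_mult)
  finally show ?thesis .
qed

text \<open>
  The upper bound on the density makes the mean of an integrable function after one step
  bounded, so all but one of the steps act on a bounded function.
\<close>

lemma n_step_L1:
  assumes \<psi>: "integrable L \<psi>"
  shows "(\<lambda>y. \<integral>z. \<psi> z \<partial>p y) \<in> borel_measurable borel"
    and "\<bar>\<integral>z. \<psi> z \<partial>p y\<bar> \<le> b * (\<integral>y. \<bar>\<psi> y\<bar> \<partial>L)"
    and "integrable (n_step p (Suc n) x) \<psi>"
    and "(\<integral>z. \<psi> z \<partial>n_step p (Suc n) x) = (\<integral>y. (\<integral>z. \<psi> z \<partial>p y) \<partial>n_step p n x)"
proof -
  have \<psi>_meas [measurable]: "\<psi> \<in> borel_measurable borel"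
    using borel_measurable_integrable[OF \<psi>] by (simp cong: measurable_cong_sets)
  show "(\<lambda>y. \<integral>z. \<psi> z \<partial>p y) \<in> borel_measurable borel"
    by (rule measurable_compose[OF measurable_prob_algebraD[OF kernel]
          integral_measurable_subprob_algebra[OF \<psi>_meas]])
  have "ennreal \<bar>\<integral>z. \<psi> z \<partial>p y\<bar> \<le> (\<integral>\<^sup>+z. ennreal \<bar>\<psi> z\<bar> \<partial>p y)"
  proof (cases "integrable (p y) \<psi>")
    case True
    then show ?thesis
      using integral_norm_bound_ennreal[OF True] by simp
  next
    case False
    then show ?thesis
      by (simp add: not_integrable_integral_eq)
  qed
  also note nn_integral_abs_kernel_le[OF \<psi>]
  finally show "\<bar>\<integral>z. \<psi> z \<partial>p y\<bar> \<le> b * (\<integral>y. \<bar>\<psi> y\<bar> \<partial>L)"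
    using b_pos by (simp add: ennreal_le_iff)
  note * = integral_bind_kernel[OF n_step_in_prob_algebra[OF kernel] kernel \<psi>_meas
      nn_integral_abs_kernel_le[OF \<psi>]]
  show "integrable (n_step p (Suc n) x) \<psi>"
    unfolding n_step_Suc[OF kernel] by (rule *(1))
  show "(\<integral>z. \<psi> z \<partial>n_step p (Suc n) x) = (\<integral>y. (\<integral>z. \<psi> z \<partial>p y) \<partial>n_step p n x)"
    unfolding n_step_Suc[OF kernel] by (rule *(2))
qed

lemma n_step_L1_oscillation:
  assumes \<psi>: "integrable L \<psi>"
  shows "\<bar>(\<integral>z. \<psi> z \<partial>n_step p (Suc n) x) - (\<integral>z. \<psi> z \<partial>n_step p (Suc n) y)\<bar>
    \<le> (1 - \<delta>) ^ n * (2 * b * (\<integral>y. \<bar>\<psi> y\<bar> \<partial>L))"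
proof -
  have "\<bar>(\<integral>z. \<psi> z \<partial>p x) - (\<integral>z. \<psi> z \<partial>p y)\<bar> \<le> 2 * b * (\<integral>y. \<bar>\<psi> y\<bar> \<partial>L)" for x y
    using n_step_L1(2)[OF \<psi>, of x] n_step_L1(2)[OF \<psi>, of y] by simp
  then show ?thesis
    unfolding n_step_L1(4)[OF \<psi>]
    by (rule n_step_contracts_oscillation[where h = "\<lambda>y. \<integral>z. \<psi> z \<partial>p y",
          OF n_step_L1(1)[OF \<psi>] n_step_L1(2)[OF \<psi>]])
qed

lemma n_step_L1_bound:
  assumes \<psi>: "integrable L \<psi>"
  shows "\<bar>\<integral>z. \<psi> z \<partial>n_step p (Suc n) x\<bar> \<le> b * (\<integral>y. \<bar>\<psi> y\<bar> \<partial>L)"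
proof -
  note k = n_step_L1[OF \<psi>]
  have P: "prob_space (n_step p n x)" "sets (n_step p n x) = sets borel"
    using in_prob_algebraD[OF n_step_in_prob_algebra[OF kernel]] by auto
  have int: "integrable (n_step p n x) (\<lambda>y. \<integral>z. \<psi> z \<partial>p y)"
    by (rule integrable_bounded[OF P k(1)]) (rule k(2))
  have "\<bar>(\<integral>y. (\<integral>z. \<psi> z \<partial>p y) \<partial>n_step p n x) - 0\<bar> \<le> b * (\<integral>y. \<bar>\<psi> y\<bar> \<partial>L)"
    by (rule prob_space.abs_integral_diff_const_le[OF P(1) int]) (simp add: k(2))
  then show ?thesis
    by (simp add: k(4))
qed

subsection \<open>Stationary measures\<close>

lemma stationary_L1:
  fixes \<psi> :: "'a \<Rightarrow> real"
  assumes \<nu>: "stationary p \<nu>" and \<psi>: "integrable L \<psi>"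
  shows "integrable \<nu> \<psi>"
    and "integrable \<nu> (\<lambda>x. \<integral>z. \<psi> z \<partial>n_step p (Suc n) x)"
    and "(\<integral>x. \<psi> x \<partial>\<nu>) = (\<integral>x. (\<integral>z. \<psi> z \<partial>n_step p (Suc n) x) \<partial>\<nu>)"
proof -
  have \<nu>': "\<nu> \<in> space (prob_algebra borel)"
    using \<nu> by (simp add: stationary_def space_prob_algebra)
  have \<psi>_meas [measurable]: "\<psi> \<in> borel_measurable borel"
    using borel_measurable_integrable[OF \<psi>] by (simp cong: measurable_cong_sets)
  have bound: "(\<integral>\<^sup>+z. ennreal \<bar>\<psi> z\<bar> \<partial>n_step p (Suc n) x) \<le> ennreal (b * (\<integral>y. \<bar>\<psi> y\<bar> \<partial>L))" for x
  proof -
    have abs: "integrable L (\<lambda>y. \<bar>\<psi> y\<bar>)"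
      using \<psi> by simp
    have "(\<integral>\<^sup>+z. ennreal \<bar>\<psi> z\<bar> \<partial>n_step p (Suc n) x) = ennreal (\<integral>z. \<bar>\<psi> z\<bar> \<partial>n_step p (Suc n) x)"
      using n_step_L1(3)[OF abs] by (intro nn_integral_eq_integral) auto
    also have "\<dots> \<le> ennreal (b * (\<integral>y. \<bar>\<psi> y\<bar> \<partial>L))"
      using n_step_L1_bound[OF abs, of n x] by (intro ennreal_leI) simp
    finally show ?thesis .
  qed
  note * = integral_bind_kernel[OF \<nu>' measurable_n_step[OF kernel] \<psi>_meas bound,
      unfolded stationary_bind_n_step_eq[OF kernel \<nu>]]
  show "integrable \<nu> \<psi>"
    by (rule *(1))
  show "(\<integral>x. \<psi> x \<partial>\<nu>) = (\<integral>x. (\<integral>z. \<psi> z \<partial>n_step p (Suc n) x) \<partial>\<nu>)"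
    by (rule *(2))
  have "(\<lambda>x. \<integral>z. \<psi> z \<partial>n_step p (Suc n) x) \<in> borel_measurable borel"
    using measurable_prob_algebraD[OF measurable_n_step[OF kernel, of "Suc n"]] by measurable
  then show "integrable \<nu> (\<lambda>x. \<integral>z. \<psi> z \<partial>n_step p (Suc n) x)"
    using \<nu> n_step_L1_bound[OF \<psi>]
    by (intro integrable_bounded) (auto simp: stationary_def)
qed

text \<open>
  By stationarity, \<open>\<integral>\<psi> d\<nu>\<close> is the \<open>\<nu>\<close>-average of the means of \<open>\<psi>\<close> after \<open>n + 1\<close> steps, so it
  differs from each of them by at most their oscillation.
\<close>

lemma n_step_converges_to_stationary:
  assumes \<nu>: "stationary p \<nu>" and \<psi>: "integrable L \<psi>"
  shows "\<bar>(\<integral>z. \<psi> z \<partial>n_step p (Suc n) x) - (\<integral>z. \<psi> z \<partial>\<nu>)\<bar>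
    \<le> (1 - \<delta>) ^ n * (2 * b * (\<integral>y. \<bar>\<psi> y\<bar> \<partial>L))"
proof -
  have "prob_space \<nu>"
    using \<nu> by (simp add: stationary_def)
  then have "\<bar>(\<integral>x. (\<integral>z. \<psi> z \<partial>n_step p (Suc n) x) \<partial>\<nu>) - (\<integral>z. \<psi> z \<partial>n_step p (Suc n) x)\<bar>
      \<le> (1 - \<delta>) ^ n * (2 * b * (\<integral>y. \<bar>\<psi> y\<bar> \<partial>L))"
    by (rule prob_space.abs_integral_diff_const_le)
      (rule stationary_L1(2)[OF \<nu> \<psi>] n_step_L1_oscillation[OF \<psi>])+
  then show ?thesis
    by (simp add: stationary_L1(3)[OF \<nu> \<psi>, of n] abs_minus_commute)
qed

text \<open>
  The limit of \<open>n_step p n x A\<close> does not mention the stationary measure, yet equals its value at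
  \<open>A\<close>. The starting point is immaterial, and \<open>undefined\<close> serves.
\<close>

lemma stationary_unique:
  assumes \<mu>: "stationary p \<mu>" and \<nu>: "stationary p \<nu>"
  shows "\<nu> = \<mu>"
proof (rule measure_eqI)
  show "sets \<nu> = sets \<mu>"
    using \<mu> \<nu> by (simp add: stationary_def)
  fix A assume "A \<in> sets \<nu>"
  then have A [measurable]: "A \<in> sets borel"
    using \<nu> by (simp add: stationary_def)
  have lim: "(\<lambda>n. \<integral>z. indicator A z \<partial>n_step p (Suc n) undefined) \<longlonglongrightarrow> measure \<kappa> A"
    if \<kappa>: "stationary p \<kappa>" for \<kappa>
  proof -
    have int: "integrable L (indicator A :: 'a \<Rightarrow> real)"
      by (simp add: L.emeasure_eq_measure)
    have "(\<lambda>n. (1 - \<delta>) ^ n) \<longlonglongrightarrow> 0"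
      using delta by (intro LIMSEQ_power_zero) auto
    then have rate: "(\<lambda>n. (1 - \<delta>) ^ n * (2 * b * (\<integral>y. \<bar>indicator A y\<bar> \<partial>L))) \<longlonglongrightarrow> 0"
      by (rule tendsto_mult_left_zero)
    have "(\<lambda>n. (\<integral>z. indicator A z \<partial>n_step p (Suc n) undefined) - (\<integral>z. indicator A z \<partial>\<kappa>))
        \<longlonglongrightarrow> (0::real)"
    proof (rule Lim_null_comparison[OF _ rate], rule always_eventually, rule allI)
      fix n
      show "norm ((\<integral>z. indicator A z \<partial>n_step p (Suc n) undefined) - (\<integral>z. indicator A z \<partial>\<kappa>) :: real)
          \<le> (1 - \<delta>) ^ n * (2 * b * (\<integral>y. \<bar>indicator A y\<bar> \<partial>L))"
        unfolding real_norm_def by (rule n_step_converges_to_stationary[OF \<kappa> int])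
    qed
    moreover have "(\<integral>z. indicator A z \<partial>\<kappa>) = measure \<kappa> A"
      using \<kappa> A by (simp add: stationary_def sets_eq_imp_space_eq[of \<kappa> borel])
    ultimately show ?thesis
      by (simp add: LIM_zero_iff)
  qed
  interpret \<mu>: prob_space \<mu> using \<mu> by (simp add: stationary_def)
  interpret \<nu>: prob_space \<nu> using \<nu> by (simp add: stationary_def)
  show "emeasure \<nu> A = emeasure \<mu> A"
    using LIMSEQ_unique[OF lim[OF \<nu>] lim[OF \<mu>]]
    by (simp add: \<mu>.emeasure_eq_measure \<nu>.emeasure_eq_measure)
qed

definition residual_iterate :: "nat \<Rightarrow> 'a measure" where
  "residual_iterate k = ((\<lambda>M. bind M residual) ^^ k) L"

text \<open>
  The law of the chain when the time since its last restart is geometric.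
\<close>

definition regeneration_measure :: "'a measure" where
  "regeneration_measure = bind (measure_pmf (geometric_pmf \<delta>)) residual_iterate"

lemma residual_iterate_in: "residual_iterate k \<in> space (prob_algebra borel)"
proof (induction k)
  case 0
  then show ?case by (simp add: residual_iterate_def reference)
next
  case (Suc k)
  then show ?case
    using prob_space_bind'[OF Suc residual_measurable] sets_bind'[OF Suc residual_measurable]
    by (simp add: residual_iterate_def space_prob_algebra)
qed

lemma residual_iterate_measurable:
  "residual_iterate \<in> measure_pmf (geometric_pmf \<delta>) \<rightarrow>\<^sub>M prob_algebra borel"
  using residual_iterate_in by (simp add: measurable_def)

lemma nn_integral_regeneration_measure:
  assumes "h \<in> borel_measurable borel"
  shows "(\<integral>\<^sup>+x. h x \<partial>regeneration_measure) =
    (\<Sum>k. ennreal ((1 - \<delta>) ^ k * \<delta>) * (\<integral>\<^sup>+x. h x \<partial>residual_iterate k))"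
  using delta unfolding regeneration_measure_def
  by (simp add: nn_integral_bind[OF assms measurable_prob_algebraD[OF residual_iterate_measurable]]
      nn_integral_measure_pmf nn_integral_count_space_nat)

text \<open>
  One step of the chain either restarts it, which yields the term \<open>\<delta> L\<close> since the weights sum to
  one, or raises the time since the last restart by one, which shifts the series. Together they
  give the whole series back.
\<close>

lemma stationary_regeneration_measure: "stationary p regeneration_measure"
  unfolding stationary_def
proof (intro conjI ballI)
  have "measure_pmf (geometric_pmf \<delta>) \<in> space (prob_algebra (measure_pmf (geometric_pmf \<delta>)))"
    by (simp add: space_prob_algebra measure_pmf.prob_space_axioms)
  note prob_space_bind'[OF this residual_iterate_measurable]
    sets_bind'[OF this residual_iterate_measurable]
  then show "prob_space regeneration_measure" "sets regeneration_measure = sets borel"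
    by (simp_all add: regeneration_measure_def)
  fix A :: "'a set" assume A [measurable]: "A \<in> sets borel"
  let ?m = "\<lambda>k. emeasure (residual_iterate k) A"
  let ?w = "\<lambda>k. ennreal ((1 - \<delta>) ^ k * \<delta>)"
  have pA: "(\<lambda>x. emeasure (p x) A) \<in> borel_measurable borel"
    using measurable_prob_algebraD[OF kernel] by measurable
  have rA [measurable]: "(\<lambda>x. emeasure (residual x) A) \<in> borel_measurable borel"
    using measurable_prob_algebraD[OF residual_measurable] by measurable
  have step: "(\<integral>\<^sup>+x. emeasure (p x) A \<partial>residual_iterate k) =
      ennreal \<delta> * ?m 0 + ennreal (1 - \<delta>) * ?m (Suc k)" for k
  proof -
    note N = in_prob_algebraD[OF residual_iterate_in[of k]]
    interpret N: prob_space "residual_iterate k" by (rule N)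
    have [measurable]: "(\<lambda>x. emeasure (residual x) A) \<in> borel_measurable (residual_iterate k)"
      using rA by (simp add: N(2) cong: measurable_cong_sets)
    have "(\<integral>\<^sup>+x. emeasure (p x) A \<partial>residual_iterate k) = ennreal \<delta> * emeasure L A +
        ennreal (1 - \<delta>) * (\<integral>\<^sup>+x. emeasure (residual x) A \<partial>residual_iterate k)"
      by (simp add: emeasure_kernel_split nn_integral_add nn_integral_cmult N.emeasure_space_1)
    also have "(\<integral>\<^sup>+x. emeasure (residual x) A \<partial>residual_iterate k) = ?m (Suc k)"
      by (simp add: residual_iterate_def
          emeasure_bind_prob_algebra[OF residual_iterate_in[unfolded residual_iterate_def] residual_measurable A])
    finally show ?thesis
      by (simp add: residual_iterate_def)
  qed
  have w_sum: "(\<Sum>k. ?w k) = 1"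
    using nn_integral_measure_pmf[of "geometric_pmf \<delta>" "\<lambda>_. 1"] delta
    by (simp add: nn_integral_count_space_nat measure_pmf.emeasure_space_1[simplified])
  have "(\<integral>\<^sup>+x. emeasure (p x) A \<partial>regeneration_measure) =
      (\<Sum>k. ?w k * (ennreal \<delta> * ?m 0 + ennreal (1 - \<delta>) * ?m (Suc k)))"
    by (simp add: nn_integral_regeneration_measure[OF pA] step)
  also have "\<dots> = (\<Sum>k. ?w k * (ennreal \<delta> * ?m 0) + ?w (Suc k) * ?m (Suc k))"
  proof -
    have "?w k * ennreal (1 - \<delta>) = ?w (Suc k)" for k
      using delta by (simp add: ennreal_mult[symmetric] mult_ac)
    then show ?thesis
      by (simp add: ring_distribs mult.assoc[symmetric])
  qed
  also have "\<dots> = (\<Sum>k. ?w k) * (ennreal \<delta> * ?m 0) + (\<Sum>k. ?w (Suc k) * ?m (Suc k))"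
    by (simp only: suminf_add[OF summableI summableI, symmetric] ennreal_suminf_multc)
  also have "\<dots> = ?w 0 * ?m 0 + (\<Sum>k. ?w (Suc k) * ?m (Suc k))"
    by (simp add: w_sum)
  also have "\<dots> = (\<Sum>k. ?w k * ?m k)"
    using suminf_offset[OF summableI, of "\<lambda>k. ?w k * ?m k" 1] by simp
  also have "\<dots> = emeasure regeneration_measure A"
    using nn_integral_regeneration_measure[of "indicator A"] A
      \<open>sets regeneration_measure = sets borel\<close>
      in_prob_algebraD(2)[OF residual_iterate_in] by simp
  finally show "(\<integral>\<^sup>+x. emeasure (p x) A \<partial>regeneration_measure) = emeasure regeneration_measure A" .
qed

subsection \<open>Decay of correlations\<close>

lemma stationary_absolutely_continuous:
  assumes \<nu>: "stationary p \<nu>" and ae: "AE x in L. P x"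
  shows "AE x in \<nu>. P x"
proof -
  obtain N where N: "{x \<in> space L. \<not> P x} \<subseteq> N" "emeasure L N = 0" "N \<in> sets L"
    using ae by (rule AE_E)
  then have N': "N \<in> sets borel"
    by simp
  have "emeasure (p x) N = 0" for x
    using nn_integral_kernel_le[of "indicator N" x] N N' by simp
  moreover have "emeasure \<nu> N = (\<integral>\<^sup>+x. emeasure (p x) N \<partial>\<nu>)"
    using \<nu> N' by (simp add: stationary_def)
  ultimately have "emeasure \<nu> N = 0"
    by simp
  moreover have "{x \<in> space \<nu>. \<not> P x} \<subseteq> N"
    using N(1) \<nu> by (auto simp: stationary_def sets_eq_imp_space_eq[of \<nu> borel]
        sets_eq_imp_space_eq[of L borel])
  ultimately show ?thesis
    using N' \<nu> by (intro AE_I[of _ _ N]) (auto simp: stationary_def)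
qed

lemma stationary_Linfty:
  assumes \<nu>: "stationary p \<nu>" and \<phi>: "\<phi> \<in> Linfty L"
  shows "\<phi> \<in> borel_measurable \<nu>" and "AE x in \<nu>. \<bar>\<phi> x\<bar> \<le> Linfty_norm L \<phi>"
proof -
  show "\<phi> \<in> borel_measurable \<nu>"
    using \<phi> \<nu> by (simp add: Linfty_def stationary_def cong: measurable_cong_sets)
  have "\<bar>\<phi> x\<bar> \<le> Linfty_norm L \<phi>" if "ereal \<bar>\<phi> x\<bar> \<le> esssup L (\<lambda>x. ereal \<bar>\<phi> x\<bar>)" for x
    using that \<phi> by (cases "esssup L (\<lambda>x. ereal \<bar>\<phi> x\<bar>)") (auto simp: Linfty_def Linfty_norm_def)
  then have "AE x in L. \<bar>\<phi> x\<bar> \<le> Linfty_norm L \<phi>"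
    using esssup_AE[of "\<lambda>x. ereal \<bar>\<phi> x\<bar>" L] by auto
  then show "AE x in \<nu>. \<bar>\<phi> x\<bar> \<le> Linfty_norm L \<phi>"
    by (rule stationary_absolutely_continuous[OF \<nu>])
qed

lemma decay_of_correlations:
  assumes \<nu>: "stationary p \<nu>" and \<phi>: "\<phi> \<in> Linfty L" and \<psi>: "integrable L \<psi>"
  shows "integrable \<nu> \<phi>"
    and "integrable \<nu> (\<lambda>x. (\<integral>y. \<psi> y \<partial>n_step p (Suc n) x) * \<phi> x)"
    and "\<bar>(\<integral>x. (\<integral>y. \<psi> y \<partial>n_step p (Suc n) x) * \<phi> x \<partial>\<nu>) - (\<integral>x. \<phi> x \<partial>\<nu>) * (\<integral>x. \<psi> x \<partial>\<nu>)\<bar>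
      \<le> (1 - \<delta>) ^ n * (2 * b) * Linfty_norm L \<phi> * L1_norm L \<psi>"
proof -
  interpret \<nu>: prob_space \<nu> using \<nu> by (simp add: stationary_def)
  note [measurable] = stationary_Linfty(1)[OF \<nu> \<phi>]
  note ae = stationary_Linfty(2)[OF \<nu> \<phi>]
  let ?k = "\<lambda>x. \<integral>y. \<psi> y \<partial>n_step p (Suc n) x"
  let ?E = "(1 - \<delta>) ^ n * (2 * b * (\<integral>y. \<bar>\<psi> y\<bar> \<partial>L))"
  have E: "0 \<le> ?E"
    using delta b_pos by simp
  show i\<phi>: "integrable \<nu> \<phi>"
    using ae by (intro \<nu>.integrable_const_bound[where B = "Linfty_norm L \<phi>"]) auto
  have km [measurable]: "?k \<in> borel_measurable \<nu>"
    by (rule borel_measurable_integrable[OF stationary_L1(2)[OF \<nu> \<psi>]])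
  show ik: "integrable \<nu> (\<lambda>x. ?k x * \<phi> x)"
  proof (rule \<nu>.integrable_const_bound)
    show "AE x in \<nu>. norm (?k x * \<phi> x) \<le> b * (\<integral>y. \<bar>\<psi> y\<bar> \<partial>L) * Linfty_norm L \<phi>"
      using ae
    proof eventually_elim
      case (elim x)
      then show ?case
        using n_step_L1_bound[OF \<psi>, of n x] unfolding real_norm_def abs_mult
        by (intro mult_mono) auto
    qed
  qed simp
  have "(\<integral>x. ?k x * \<phi> x \<partial>\<nu>) - (\<integral>x. \<phi> x \<partial>\<nu>) * (\<integral>x. \<psi> x \<partial>\<nu>) =
      (\<integral>x. ?k x * \<phi> x - \<phi> x * (\<integral>x. \<psi> x \<partial>\<nu>) \<partial>\<nu>)"
    using ik i\<phi> by simp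
  also have "\<bar>\<dots>\<bar> \<le> (\<integral>x. \<bar>?k x * \<phi> x - \<phi> x * (\<integral>x. \<psi> x \<partial>\<nu>)\<bar> \<partial>\<nu>)"
    by (rule integral_abs_bound)
  also have "\<dots> \<le> (\<integral>x. ?E * Linfty_norm L \<phi> \<partial>\<nu>)"
  proof (rule integral_mono_AE)
    show "integrable \<nu> (\<lambda>x. \<bar>?k x * \<phi> x - \<phi> x * (\<integral>x. \<psi> x \<partial>\<nu>)\<bar>)"
      using ik i\<phi> by simp
    show "AE x in \<nu>. \<bar>?k x * \<phi> x - \<phi> x * (\<integral>x. \<psi> x \<partial>\<nu>)\<bar> \<le> ?E * Linfty_norm L \<phi>"
      using ae
    proof eventually_elim
      case (elim x)
      have "\<bar>?k x * \<phi> x - \<phi> x * (\<integral>x. \<psi> x \<partial>\<nu>)\<bar> = \<bar>?k x - (\<integral>x. \<psi> x \<partial>\<nu>)\<bar> * \<bar>\<phi> x\<bar>"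
        by (simp add: abs_mult[symmetric] algebra_simps)
      also have "\<dots> \<le> ?E * Linfty_norm L \<phi>"
        using n_step_converges_to_stationary[OF \<nu> \<psi>, of n x] elim E by (intro mult_mono) auto
      finally show ?case .
    qed
  qed simp
  also have "\<dots> = (1 - \<delta>) ^ n * (2 * b) * Linfty_norm L \<phi> * L1_norm L \<psi>"
    by (simp add: \<nu>.prob_space L1_norm_def mult_ac)
  finally show "\<bar>(\<integral>x. ?k x * \<phi> x \<partial>\<nu>) - (\<integral>x. \<phi> x \<partial>\<nu>) * (\<integral>x. \<psi> x \<partial>\<nu>)\<bar>
      \<le> (1 - \<delta>) ^ n * (2 * b) * Linfty_norm L \<phi> * L1_norm L \<psi>" .
qed

end

section \<open>Continuous families of densities\<close>

lemma holder_continuous_imp_continuous: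
  assumes "holder_continuous \<alpha> h" "\<alpha> > 0"
  shows "continuous_on UNIV h"
proof -
  obtain H where H: "\<And>x y. \<bar>h x - h y\<bar> \<le> H * dist x y powr \<alpha>"
    using assms by (auto simp: holder_continuous_def)
  have "(h \<longlongrightarrow> h x) (at x)" for x
  proof -
    have "((\<lambda>y. dist y x) \<longlongrightarrow> 0) (at x)"
      using tendsto_dist[OF tendsto_ident_at[of x UNIV] tendsto_const[of x]] by simp
    then have "((\<lambda>y. dist y x powr \<alpha>) \<longlongrightarrow> 0 powr \<alpha>) (at x)"
      by (rule tendsto_powr'[OF _ tendsto_const]) (simp add: assms)
    then have lim: "((\<lambda>y. H * dist y x powr \<alpha>) \<longlongrightarrow> 0) (at x)"
      by (intro tendsto_mult_right_zero) simp
    have "\<forall>\<^sub>F y in at x. norm (h y - h x) \<le> H * dist y x powr \<alpha>"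
      unfolding real_norm_def by (rule always_eventually, rule allI, rule H)
    then have "((\<lambda>y. h y - h x) \<longlongrightarrow> 0) (at x)"
      by (rule Lim_null_comparison[OF _ lim])
    then show ?thesis
      by (simp add: LIM_zero_iff)
  qed
  then show ?thesis
    by (simp add: continuous_on_def)
qed

text \<open>
  Uniform convergence of the densities makes \<open>x \<mapsto> p x A\<close> continuous for every Borel set \<open>A\<close>, in
  particular measurable.
\<close>

lemma continuous_densities_kernel:
  fixes q :: "'a::metric_space \<Rightarrow> 'a \<Rightarrow> real"
  assumes L: "L \<in> space (prob_algebra borel)"
    and prob: "\<And>x. prob_space (p x)"
    and p: "\<And>x. p x = density L (\<lambda>y. ennreal (q x y))"
    and q_meas: "\<And>x. q x \<in> borel_measurable borel"
    and q_pos: "\<And>x y. 0 \<le> q x y" and q_bound: "\<And>x y. q x y \<le> b"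
    and q_cont: "\<And>x. uniform_limit UNIV q (q x) (at x)"
  shows "p \<in> borel \<rightarrow>\<^sub>M prob_algebra borel"
proof (rule measurable_prob_algebraI[OF prob measurable_subprob_algebra])
  interpret L: prob_space L
    using in_prob_algebraD[OF L] by simp
  have [measurable_cong]: "sets L = sets borel"
    using in_prob_algebraD[OF L] by simp
  fix A :: "'a set" assume A [measurable]: "A \<in> sets borel"
  note [measurable] = q_meas
  define m where "m = (\<lambda>x. \<integral>y. q x y * indicator A y \<partial>L)"
  have int: "integrable L (\<lambda>y. q x y * indicator A y)" for x
    using q_pos q_bound order_trans[OF q_pos q_bound]
    by (intro L.integrable_const_bound[where B = b]) (auto split: split_indicator)
  have "(m \<longlongrightarrow> m x) (at x)" for x
  proof (rule tendstoI)
    fix e :: real assume e: "e > 0"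
    have "\<forall>\<^sub>F x' in at x. \<forall>y\<in>UNIV. dist (q x' y) (q x y) < e / 2"
      using q_cont[of x] e by (intro uniform_limitD) auto
    then show "\<forall>\<^sub>F x' in at x. dist (m x') (m x) < e"
    proof eventually_elim
      case (elim x')
      have "m x' - m x = (\<integral>y. q x' y * indicator A y - q x y * indicator A y \<partial>L)"
        unfolding m_def using int by simp
      also have "\<bar>\<dots>\<bar> \<le> (\<integral>y. \<bar>q x' y * indicator A y - q x y * indicator A y\<bar> \<partial>L)"
        by (rule integral_abs_bound)
      also have "\<dots> \<le> (\<integral>y. e / 2 \<partial>L)"
        using elim e int
        by (intro integral_mono)
          (auto split: split_indicator simp: dist_real_def less_imp_le)
      also have "\<dots> < e"
        using e by (simp add: L.prob_space)
      finally show ?case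
        by (simp add: dist_real_def)
    qed
  qed
  then have "continuous_on UNIV m"
    by (simp add: continuous_on_def)
  then have "(\<lambda>x. ennreal (m x)) \<in> borel_measurable borel"
    by (intro measurable_compose[OF borel_measurable_continuous_onI measurable_ennreal])
  moreover have "emeasure (p x) A = ennreal (m x)" for x
  proof -
    have "emeasure (p x) A = (\<integral>\<^sup>+y. ennreal (q x y) * indicator A y \<partial>L)"
      by (simp add: p emeasure_density)
    also have "\<dots> = (\<integral>\<^sup>+y. ennreal (q x y * indicator A y) \<partial>L)"
      by (intro nn_integral_cong) (simp split: split_indicator)
    also have "\<dots> = ennreal (m x)"
      unfolding m_def using int q_pos by (intro nn_integral_eq_integral) auto
    finally show ?thesis .
  qed
  ultimately show "(\<lambda>x. emeasure (p x) A) \<in> borel_measurable borel"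
    by simp
qed (use prob in_prob_algebraD[OF L] in \<open>auto simp: p prob_space_imp_subprob_space\<close>)

lemma density_bounds_extend_to_closure:
  fixes q :: "'a::topological_space \<Rightarrow> 'b \<Rightarrow> real"
  assumes q_cont: "\<And>x. uniform_limit UNIV q (q x) (at x)"
    and bounds: "\<And>x. x \<in> Y \<Longrightarrow> l \<le> q x y \<and> q x y \<le> u" and x: "x \<in> closure Y"
  shows "l \<le> q x y \<and> q x y \<le> u"
proof -
  have "continuous_on UNIV (\<lambda>x. q x y)"
    using tendsto_uniform_limitI[OF q_cont, of y] by (simp add: continuous_on_def)
  then have "closed ((\<lambda>x. q x y) -` {l..u})"
    by (intro closed_vimage) auto
  then have "closure Y \<subseteq> (\<lambda>x. q x y) -` {l..u}"
    using bounds by (intro closure_minimal) auto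
  then show ?thesis
    using x by auto
qed

text \<open>
  The uniform measure is null if \<open>M\<close> has total mass \<open>0\<close> or \<open>\<infinity>\<close>, and then so is every
  density with respect to it.
\<close>

lemma uniform_measure_prob_of_density:
  assumes d: "d \<in> borel_measurable M"
    and prob: "prob_space (density (uniform_measure M (space M)) d)"
  shows "prob_space (uniform_measure M (space M))"
proof (rule prob_space_uniform_measure)
  let ?U = "uniform_measure M (space M)"
  have nz: "emeasure ?U (space M) \<noteq> 0"
  proof
    assume "emeasure ?U (space M) = 0"
    then have "space M \<in> null_sets ?U"
      by (intro null_setsI) auto
    moreover have "absolutely_continuous ?U (density ?U d)"
      using d by (intro absolutely_continuousI_density) simp
    ultimately have "space M \<in> null_sets (density ?U d)"
      by (auto simp: absolutely_continuous_def)
    then show False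
      using prob_space.emeasure_space_1[OF prob] by (simp add: null_sets_def)
  qed
  then show "emeasure M (space M) \<noteq> 0" "emeasure M (space M) \<noteq> \<infinity>"
    by auto
qed

theorem theorem2:
  fixes \<A> :: "('a::metric_space, 'n::finite) chart set"
    and g :: "('a, 'n) chart \<Rightarrow> 'a \<Rightarrow> real^'n^'n"
    and vol Leb :: "'a measure"
    and p :: "'a \<Rightarrow> 'a measure"
    and q :: "'a \<Rightarrow> 'a \<Rightarrow> real"
    and f :: "'a \<Rightarrow> 'a"
    and Y :: "'a set"
    and x0 :: 'a
    and \<rho>0 qlow qup :: real
  assumes manifold: "compact_connected_riemannian_manifold \<A> g"
    and volume: "riemannian_volume \<A> g vol"
    and Leb: "Leb = uniform_measure vol UNIV"
    and prob: "\<And>x. prob_space (p x)"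
    and p_cont: "weakly_continuous p"
    and p_density: "\<And>x. p x = density Leb (\<lambda>y. ennreal (q x y))"
    and q_pos: "\<And>x y. q x y > 0"
    and q_holder: "\<And>x. \<exists>\<alpha>>0. holder_continuous \<alpha> (q x)"
    and q_cont: "\<And>x. uniform_limit UNIV q (q x) (at x)"
    and constants: "\<rho>0 > 0" "qlow > 0" "qup > qlow"
    and Y_full: "AE x in Leb. x \<in> Y"
    and f_cont: "continuous_on Y f"
    and supp: "\<And>x. x \<in> Y \<Longrightarrow> ball (f x) \<rho>0 \<subseteq> closure {y. q x y \<noteq> 0}"
    and q_bounds: "\<And>x y. x \<in> Y \<Longrightarrow> qlow \<le> q x y \<and> q x y \<le> qup"
    and orbit_dense: "closure (range (\<lambda>n. (f ^^ n) x0)) = UNIV"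
    and orbit_Y: "range (\<lambda>n. (f ^^ n) x0) \<subseteq> Y"
  shows "\<exists>\<mu>. stationary p \<mu> \<and> (\<forall>\<nu>. stationary p \<nu> \<longrightarrow> \<nu> = \<mu>) \<and>
           (\<exists>C>0. \<exists>lam>1. \<forall>\<phi> \<psi>. \<forall>n\<ge>1.
              \<phi> \<in> Linfty Leb \<longrightarrow> integrable Leb \<psi> \<longrightarrow>
              (\<forall>x. integrable (n_step p n x) \<psi>) \<and>
              integrable \<mu> (\<lambda>x. (\<integral>y. \<psi> y \<partial>n_step p n x) * \<phi> x) \<and>
              integrable \<mu> \<phi> \<and> integrable \<mu> \<psi> \<and>
              \<bar>(\<integral>x. (\<integral>y. \<psi> y \<partial>n_step p n x) * \<phi> x \<partial>\<mu>) - (\<integral>x. \<phi> x \<partial>\<mu>) * (\<integral>x. \<psi> x \<partial>\<mu>)\<bar>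
                \<le> C * lam powr (- real n) * Linfty_norm Leb \<phi> * L1_norm Leb \<psi>)"
proof -
  have sets_Leb: "sets Leb = sets borel"
    using volume by (simp add: Leb riemannian_volume_def)
  have q_meas: "q x \<in> borel_measurable borel" for x
    using q_holder[of x] holder_continuous_imp_continuous borel_measurable_continuous_onI by blast
  have "space vol = UNIV"
    using volume by (simp add: riemannian_volume_def sets_eq_imp_space_eq[of vol borel])
  moreover have "q x0 \<in> borel_measurable vol"
    using q_meas volume by (simp add: riemannian_volume_def cong: measurable_cong_sets)
  ultimately have "prob_space Leb"
    using uniform_measure_prob_of_density[of "\<lambda>y. ennreal (q x0 y)" vol] prob[of x0]
    by (simp add: p_density Leb)
  then have Leb_in: "Leb \<in> space (prob_algebra borel)"
    using sets_Leb by (simp add: space_prob_algebra)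
  have "closure Y = UNIV"
    using closure_mono[OF orbit_Y] orbit_dense by auto
  then have bounds: "qlow \<le> q x y" "q x y \<le> qup" for x y
    using density_bounds_extend_to_closure[OF q_cont q_bounds, where x = x and y = y] by auto
  \<comment> \<open>If \<open>qlow = 1\<close> then \<open>q = 1\<close> almost everywhere and no residual part is left for \<open>\<delta> = qlow\<close>;
     the minimum keeps \<open>1 - \<delta>\<close> positive, and with it the rate \<open>lam\<close> well defined.\<close>
  define \<delta> where "\<delta> = min qlow (1 / 2)"
  have \<delta>: "0 < \<delta>" "\<delta> < 1" "\<delta> \<le> qlow"
    using constants by (auto simp: \<delta>_def)
  have "p \<in> borel \<rightarrow>\<^sub>M prob_algebra borel"
    by (rule continuous_densities_kernel[OF Leb_in prob p_density q_meas _ bounds(2) q_cont])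
      (simp add: q_pos less_imp_le)
  then interpret doeblin_chain Leb p q \<delta> qup
    using Leb_in q_meas p_density bounds \<delta> order_trans[OF \<delta>(3) bounds(1)]
    by unfold_locales auto
  define lam where "lam = 1 / (1 - \<delta>)"
  \<comment> \<open>The factor \<open>lam\<close> pays for the first step, which does not contract.\<close>
  define C where "C = 2 * qup * lam"
  have lam: "1 < lam"
    using \<delta> by (simp add: lam_def)
  have C: "0 < C"
    using b_pos lam by (simp add: C_def)
  have rate: "(1 - \<delta>) ^ n * (2 * qup) = C * lam powr (- real (Suc n))" for n
  proof -
    have "lam powr (- real (Suc n)) = (1 - \<delta>) ^ Suc n"
      using lam \<delta> by (simp add: powr_minus powr_realpow lam_def power_one_over del: power_Suc of_nat_Suc)
    then show ?thesis
      using \<delta> by (simp add: C_def lam_def)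
  qed
  have main: "(\<forall>x. integrable (n_step p n x) \<psi>) \<and>
      integrable regeneration_measure (\<lambda>x. (\<integral>y. \<psi> y \<partial>n_step p n x) * \<phi> x) \<and>
      integrable regeneration_measure \<phi> \<and> integrable regeneration_measure \<psi> \<and>
      \<bar>(\<integral>x. (\<integral>y. \<psi> y \<partial>n_step p n x) * \<phi> x \<partial>regeneration_measure) -
        (\<integral>x. \<phi> x \<partial>regeneration_measure) * (\<integral>x. \<psi> x \<partial>regeneration_measure)\<bar>
      \<le> C * lam powr (- real n) * Linfty_norm Leb \<phi> * L1_norm Leb \<psi>"
    if "n \<ge> 1" and \<phi>: "\<phi> \<in> Linfty Leb" and \<psi>: "integrable Leb \<psi>" for \<phi> \<psi> n
  proof -
    obtain m where m: "n = Suc m"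
      using \<open>n \<ge> 1\<close> by (cases n) auto
    note s = stationary_regeneration_measure
    show ?thesis
      unfolding m
      using n_step_L1(3)[OF \<psi>] stationary_L1(1)[OF s \<psi>] decay_of_correlations(1)[OF s \<phi> \<psi>]
        decay_of_correlations(2,3)[OF s \<phi> \<psi>, of m]
      unfolding rate by (intro conjI allI)
  qed
  show ?thesis
    by (rule exI[of _ regeneration_measure], rule conjI[OF stationary_regeneration_measure], rule conjI,
        intro allI impI, erule stationary_unique[OF stationary_regeneration_measure],
        rule exI[of _ C], rule conjI[OF C], rule exI[of _ lam], rule conjI[OF lam],
        intro allI impI, erule (2) main)
qed

end
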